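(* Let $n$ be a positive integer and $\delta = \min_{h\in\mathcal H}|n-h|$. Then \[\mathcal R(n) \ge \left(\frac{4}{ne}\right)^{\delta/2}.\]
   Context: Let $\mathcal H$ be the set of positive integers $h$ for which a Hadamard matrix of order $h$ exists (an $h\times h$ matrix with entries in $\{+1,-1\}$ and absolute determinant $h^{h/2}$). For a positive integer $n$, $D(n)$ denotes the maximum of $\det M$ over all $n\times n$ matrices $M$ with entries in $\{+1,-1\}$, and $\mathcal R(n) := D(n)/n^{n/2}$. *)

theory Defs
  imports Complex_Main "Jordan_Normal_Form.Determinant"
begin

definition pm1_mats :: "nat \<Rightarrow> real mat set" where
  "pm1_mats n = {M \<in> carrier_mat n n. \<forall>i<n. \<forall>j<n. M $$ (i, j) \<in> {1, -1}}"

definition hadamard_matrix :: "nat \<Rightarrow> real mat \<Rightarrow> bool" where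
  "hadamard_matrix h M \<longleftrightarrow> M \<in> pm1_mats h \<and> \<bar>det M\<bar> = real h powr (real h / 2)"

definition hadamard_orders :: "nat set" where
  "hadamard_orders = {h. h > 0 \<and> (\<exists>M. hadamard_matrix h M)}"

definition maxdet :: "nat \<Rightarrow> real" where
  "maxdet n = Max (det ` pm1_mats n)"

definition maxdet_ratio :: "nat \<Rightarrow> real" where
  "maxdet_ratio n = maxdet n / real n powr (real n / 2)"

(* The set of Hadamard orders is infinite, so Min is not usable here. Inf on nat is
   the least element of a nonempty set, and hadamard_gap_attained shows that it is attained. *)
definition hadamard_gap :: "nat \<Rightarrow> nat" where
  "hadamard_gap n = (INF h\<in>hadamard_orders. nat \<bar>int n - int h\<bar>)"

lemma finite_pm1_mats: "finite (pm1_mats n)"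
proof -
  let ?F = "({..<n} \<times> {..<n}) \<rightarrow>\<^sub>E {1, -1 :: real}"
  have "pm1_mats n \<subseteq> mat n n ` ?F"
  proof
    fix M assume "M \<in> pm1_mats n"
    then have M: "M \<in> carrier_mat n n"
      and e: "\<And>i j. i < n \<Longrightarrow> j < n \<Longrightarrow> M $$ (i, j) \<in> {1, -1}"
      by (auto simp: pm1_mats_def)
    have "M = mat n n (restrict (($$) M) ({..<n} \<times> {..<n}))"
      using M by (intro eq_matI) auto
    moreover have "restrict (($$) M) ({..<n} \<times> {..<n}) \<in> ?F"
      using e by auto
    ultimately show "M \<in> mat n n ` ?F" by blast
  qed
  moreover have "finite ?F" by (intro finite_PiE) auto
  ultimately show ?thesis by (meson finite_imageI finite_subset)
qed

lemma pm1_mats_nonempty: "pm1_mats n \<noteq> {}"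
proof -
  have "mat n n (\<lambda>_. 1) \<in> pm1_mats n" by (simp add: pm1_mats_def)
  then show ?thesis by blast
qed

lemma one_in_hadamard_orders: "1 \<in> hadamard_orders"
proof -
  have "hadamard_matrix 1 (1\<^sub>m 1)"
    by (simp add: hadamard_matrix_def pm1_mats_def)
  then show ?thesis by (auto simp: hadamard_orders_def)
qed

lemma hadamard_gap_attained:
  "\<exists>h\<in>hadamard_orders. hadamard_gap n = nat \<bar>int n - int h\<bar>"
proof -
  have "hadamard_gap n \<in> (\<lambda>h. nat \<bar>int n - int h\<bar>) ` hadamard_orders"
    unfolding hadamard_gap_def using one_in_hadamard_orders by (intro Inf_nat_def1) blast
  then show ?thesis by blast
qed

lemma hadamard_gap_le:
  "h \<in> hadamard_orders \<Longrightarrow> hadamard_gap n \<le> nat \<bar>int n - int h\<bar>"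
  unfolding hadamard_gap_def by (intro cINF_lower) auto

end

theory Submission imports Defs begin

text \<open>
  Let h be a Hadamard order with |n - h| = d minimal. If n = h + d, bordering gives
  D(n) \<ge> 2^d h^(h/2), and ln (n/h) \<le> n/h - 1 finishes. If n = h - d with d > 0, a Hadamard
  matrix H has a nonsingular d \<times> d submatrix, of absolute determinant at least 2^(d-1);
  since H is orthogonal up to scaling, the complementary minor of order n has absolute value at
  least 2^(d-1) h^(h/2 - d). The trivial order 1 ensures d < n.
\<close>

section \<open>Schur complements and Hadamard's inequality\<close>

text \<open>One step of Gaussian elimination in block form: \<open>M\<close> is the product of
  \<open>?L\<close> = [a, 0; c, S] and the unipotent \<open>?U\<close> = [1, b; 0, I], where
  \<open>b\<close> is the rest of the first row divided by the pivot a.\<close>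

lemma det_schur_complement:
  fixes M :: "'a :: field mat"
  assumes M: "M \<in> carrier_mat (Suc k) (Suc k)" and a: "M $$ (0, 0) \<noteq> 0"
  shows "det M = M $$ (0, 0) *
    det (mat k k (\<lambda>(i, j). M $$ (Suc i, Suc j) - M $$ (Suc i, 0) * M $$ (0, Suc j) / M $$ (0, 0)))"
proof -
  let ?a = "M $$ (0, 0)"
  define S where "S = mat k k (\<lambda>(i, j). M $$ (Suc i, Suc j) - M $$ (Suc i, 0) * M $$ (0, Suc j) / ?a)"
  define c where "c = mat k 1 (\<lambda>(i, j). M $$ (Suc i, 0))"
  define b where "b = mat 1 k (\<lambda>(i, j). M $$ (0, Suc j) / ?a)"
  define A where "A = mat 1 1 (\<lambda>_. ?a)"
  let ?L = "four_block_mat A (0\<^sub>m 1 k) c S"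
  let ?U = "four_block_mat (1\<^sub>m 1) b (0\<^sub>m k 1) (1\<^sub>m k)"
  have car: "A \<in> carrier_mat 1 1" "c \<in> carrier_mat k 1" "S \<in> carrier_mat k k" "b \<in> carrier_mat 1 k"
    by (auto simp: A_def c_def S_def b_def)
  have "?L * ?U = four_block_mat (A * 1\<^sub>m 1 + 0\<^sub>m 1 k * 0\<^sub>m k 1) (A * b + 0\<^sub>m 1 k * 1\<^sub>m k)
      (c * 1\<^sub>m 1 + S * 0\<^sub>m k 1) (c * b + S * 1\<^sub>m k)"
    by (rule mult_four_block_mat) (use car in auto)
  also have "\<dots> = four_block_mat A (A * b) c (c * b + S)"
    using car by simp
  also have "\<dots> = M"
  proof (rule eq_matI)
    fix i j assume "i < dim_row M" "j < dim_col M"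
    then have "i < Suc k" "j < Suc k" using M by auto
    then show "four_block_mat A (A * b) c (c * b + S) $$ (i, j) = M $$ (i, j)"
      using a by (cases i; cases j) (auto simp: A_def b_def c_def S_def scalar_prod_def)
  qed (use M car in auto)
  finally have "det M = det (?L * ?U)" by simp
  also have "\<dots> = det ?L * det ?U"
    by (rule det_mult[of _ "1 + k"]) (use car in auto)
  also have "det ?L = det A * det S"
    by (rule det_four_block_mat_upper_right_zero) (use car in auto)
  also have "det ?U = det (1\<^sub>m 1 :: 'a mat) * det (1\<^sub>m k :: 'a mat)"
    by (rule det_four_block_mat_lower_left_zero) (use car in auto)
  also have "det A = ?a" by (simp add: A_def det_single)
  finally show ?thesis by (simp add: S_def)
qed

text \<open>Gram-Schmidt by induction: eliminating the first row and column of a Gram matrix leaves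
  the Gram matrix of the other vectors projected away from \<open>f 0\<close>, and projection does
  not lengthen a vector.\<close>

lemma gram_det_bounds:
  fixes f :: "nat \<Rightarrow> nat \<Rightarrow> real"
  shows "0 \<le> det (mat n n (\<lambda>(i, j). \<Sum>k<m. f i k * f j k)) \<and>
    det (mat n n (\<lambda>(i, j). \<Sum>k<m. f i k * f j k)) \<le> (\<Prod>i<n. \<Sum>k<m. (f i k)\<^sup>2)"
proof (induction n arbitrary: f)
  case 0
  then show ?case by simp
next
  case (Suc n)
  let ?ip = "\<lambda>i j. \<Sum>k<m. f i k * f j k"
  let ?G = "mat (Suc n) (Suc n) (\<lambda>(i, j). ?ip i j)"
  let ?a = "?ip 0 0"
  have a0: "?a \<ge> 0" by (intro sum_nonneg) auto
  show ?case
  proof (cases "?a = 0")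
    case True
    then have z: "f 0 k = 0" if "k < m" for k
      using that by (subst (asm) sum_nonneg_eq_0_iff) auto
    have "det ?G = (\<Sum>j<Suc n. ?G $$ (0, j) * cofactor ?G 0 j)"
      by (rule laplace_expansion_row) auto
    also have "\<dots> = 0" by (intro sum.neutral) (auto simp: z)
    finally have "det ?G = 0" .
    moreover have "0 \<le> (\<Prod>i<Suc n. \<Sum>k<m. (f i k)\<^sup>2)"
      by (intro prod_nonneg sum_nonneg) auto
    ultimately show ?thesis by simp
  next
    case False
    \<comment> \<open>\<open>g i\<close> is the component of \<open>f (Suc i)\<close> orthogonal to
      \<open>f 0\<close>; \<open>ipg\<close> then says that the Schur complement of the Gram matrix
      is the Gram matrix of \<open>g\<close>.\<close>
    define g where "g i k = f (Suc i) k - ?ip (Suc i) 0 / ?a * f 0 k" for i k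
    have ipg: "(\<Sum>k<m. g i k * g j k) = ?ip (Suc i) (Suc j) - ?ip (Suc i) 0 * ?ip 0 (Suc j) / ?a" for i j
    proof -
      define x where "x = ?ip (Suc i) 0 / ?a"
      define y where "y = ?ip (Suc j) 0 / ?a"
      have "(\<Sum>k<m. g i k * g j k) =
        (\<Sum>k<m. f (Suc i) k * f (Suc j) k - y * (f (Suc i) k * f 0 k) - x * (f (Suc j) k * f 0 k)
          + x * y * (f 0 k * f 0 k))"
        by (intro sum.cong) (auto simp: g_def x_def y_def algebra_simps)
      also have "\<dots> = ?ip (Suc i) (Suc j) - y * ?ip (Suc i) 0 - x * ?ip (Suc j) 0 + x * y * ?a"
        by (simp add: sum.distrib sum_subtractf sum_distrib_left)
      also have "x * y * ?a = x * ?ip (Suc j) 0"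
        using False by (simp add: y_def)
      also have "?ip (Suc j) 0 = ?ip 0 (Suc j)" by (simp add: mult.commute)
      also have "y = ?ip 0 (Suc j) / ?a" by (simp add: y_def mult.commute)
      finally show ?thesis by simp
    qed
    let ?S = "mat n n (\<lambda>(i, j). \<Sum>k<m. g i k * g j k)"
    have "det ?G = ?G $$ (0, 0) *
      det (mat n n (\<lambda>(i, j). ?G $$ (Suc i, Suc j) - ?G $$ (Suc i, 0) * ?G $$ (0, Suc j) / ?G $$ (0, 0)))"
      by (rule det_schur_complement) (use False in auto)
    also have "mat n n (\<lambda>(i, j). ?G $$ (Suc i, Suc j) - ?G $$ (Suc i, 0) * ?G $$ (0, Suc j) / ?G $$ (0, 0)) = ?S"
      by (intro eq_matI) (auto simp: ipg)
    finally have det: "det ?G = ?a * det ?S" by simp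
    have "det ?S \<le> (\<Prod>i<n. \<Sum>k<m. (g i k)\<^sup>2)" using Suc.IH by blast
    also have "\<dots> \<le> (\<Prod>i<n. \<Sum>k<m. (f (Suc i) k)\<^sup>2)"
    proof (intro prod_mono conjI sum_nonneg)
      fix i
      \<comment> \<open>Pythagoras: the squared length drops by the square of
        \<open>?ip (Suc i) 0\<close> divided by \<open>?a\<close>.\<close>
      have "(\<Sum>k<m. (g i k)\<^sup>2) = ?ip (Suc i) (Suc i) - ?ip (Suc i) 0 * ?ip 0 (Suc i) / ?a"
        using ipg[of i i] by (simp add: power2_eq_square)
      also have "?ip 0 (Suc i) = ?ip (Suc i) 0" by (simp add: mult.commute)
      finally show "(\<Sum>k<m. (g i k)\<^sup>2) \<le> (\<Sum>k<m. (f (Suc i) k)\<^sup>2)"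
        using a0 by (simp add: power2_eq_square)
    qed auto
    finally have "?a * det ?S \<le> ?a * (\<Prod>i<n. \<Sum>k<m. (f (Suc i) k)\<^sup>2)"
      using a0 by (rule mult_left_mono)
    moreover have "0 \<le> ?a * det ?S" using a0 Suc.IH[of g] by simp
    ultimately show ?thesis
      unfolding det by (simp add: prod.lessThan_Suc_shift power2_eq_square del: prod.lessThan_Suc)
  qed
qed

text \<open>The square of the determinant is the Gram determinant of the rows.\<close>

lemma hadamard_inequality:
  fixes M :: "real mat"
  assumes M: "M \<in> carrier_mat n n"
  shows "(det M)\<^sup>2 \<le> (\<Prod>i<n. \<Sum>k<n. (M $$ (i, k))\<^sup>2)"
proof -
  have "(det M)\<^sup>2 = det (M * transpose_mat M)"
    using M by (simp add: det_mult[of _ n] det_transpose power2_eq_square)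
  also have "M * transpose_mat M = mat n n (\<lambda>(i, j). \<Sum>k<n. M $$ (i, k) * M $$ (j, k))"
    using M by (intro eq_matI) (auto simp: scalar_prod_def atLeast0LessThan)
  finally show ?thesis using gram_det_bounds[where f = "\<lambda>i k. M $$ (i, k)" and n = n and m = n] by simp
qed

section \<open>Orthogonality of the rows of a Hadamard matrix\<close>

lemma pm1_mats_square: "M \<in> pm1_mats n \<Longrightarrow> i < n \<Longrightarrow> j < n \<Longrightarrow> (M $$ (i, j))\<^sup>2 = 1"
  unfolding pm1_mats_def power2_eq_1_iff by blast

text \<open>Otherwise subtracting a multiple of one row from the other would keep the determinant
  but shorten a row, contradicting Hadamard's inequality.\<close>

lemma hadamard_matrix_orthogonal:
  assumes H: "hadamard_matrix h M" and i: "i < h" and k: "k < h" and ik: "i \<noteq> k"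
  shows "(\<Sum>j<h. M $$ (i, j) * M $$ (k, j)) = 0"
proof -
  let ?c = "\<Sum>j<h. M $$ (i, j) * M $$ (k, j)"
  have pm: "M \<in> pm1_mats h" and dM: "\<bar>det M\<bar> = real h powr (real h / 2)"
    using H by (auto simp: hadamard_matrix_def)
  then have M: "M \<in> carrier_mat h h" by (simp add: pm1_mats_def)
  have h: "h > 0" using i by simp
  \<comment> \<open>Every row has squared length \<open>h\<close>, so \<open>?c / h\<close> is the
    coefficient of the projection of row \<open>k\<close> onto row \<open>i\<close>;
    \<open>N\<close> subtracts that projection from row \<open>k\<close>.\<close>
  define N where "N = addrow (- ?c / h) k i M"
  have N: "N \<in> carrier_mat h h" using M by (simp add: N_def)
  have sq: "(\<Sum>j<h. (M $$ (l, j))\<^sup>2) = h" if "l < h" for l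
    using pm1_mats_square[OF pm that] by simp
  have norm_N: "(\<Sum>j<h. (N $$ (l, j))\<^sup>2) = (if l = k then h - ?c\<^sup>2 / h else h)" if l: "l < h" for l
  proof (cases "l = k")
    case True
    have "(\<Sum>j<h. (N $$ (l, j))\<^sup>2) =
      (\<Sum>j<h. (?c / h)\<^sup>2 * (M $$ (i, j))\<^sup>2 - 2 * (?c / h) * (M $$ (i, j) * M $$ (k, j)) + (M $$ (k, j))\<^sup>2)"
      by (intro sum.cong) (use True M k in \<open>auto simp: N_def power2_eq_square algebra_simps\<close>)
    also have "\<dots> = (?c / h)\<^sup>2 * h - 2 * (?c / h) * ?c + h"
      by (simp only: sum.distrib sum_subtractf sum_distrib_left[symmetric] sq[OF i] sq[OF k])
    also have "\<dots> = h - ?c\<^sup>2 / h"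
      using h by (simp add: field_simps power2_eq_square)
    finally show ?thesis using True by simp
  next
    case False
    have "(\<Sum>j<h. (N $$ (l, j))\<^sup>2) = (\<Sum>j<h. (M $$ (l, j))\<^sup>2)"
      by (intro sum.cong) (use False M l in \<open>auto simp: N_def\<close>)
    then show ?thesis using False sq[OF l] by simp
  qed
  have "real h ^ h = (det M)\<^sup>2"
  proof -
    have "(det M)\<^sup>2 = (real h powr (real h / 2))\<^sup>2" by (metis dM power2_abs)
    also have "\<dots> = real h powr real h" by (simp add: power2_eq_square flip: powr_add)
    finally show ?thesis using h by (simp add: powr_realpow)
  qed
  also have "det M = det N" unfolding N_def using det_addrow[OF i _ M] ik by simp
  also have "(det N)\<^sup>2 \<le> (\<Prod>l<h. \<Sum>j<h. (N $$ (l, j))\<^sup>2)" by (rule hadamard_inequality[OF N])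
  also have "\<dots> = (\<Prod>l<h. if l = k then h - ?c\<^sup>2 / h else real h)"
    using norm_N by (intro prod.cong) auto
  also have "\<dots> = (h - ?c\<^sup>2 / h) * real h ^ (h - 1)"
    using k by (subst prod.remove[of _ k]) auto
  finally have "real h * real h ^ (h - 1) \<le> (h - ?c\<^sup>2 / h) * real h ^ (h - 1)"
    using h by (simp flip: power_Suc)
  then have "?c\<^sup>2 / h \<le> 0" using h by simp
  then show ?thesis using h by (simp add: divide_le_0_iff)
qed

section \<open>Lower bound for nonzero determinants of sign matrices\<close>

lemma det_integral:
  fixes A :: "real mat"
  assumes A: "A \<in> carrier_mat n n" and "\<And>i j. i < n \<Longrightarrow> j < n \<Longrightarrow> A $$ (i, j) \<in> \<int>"
  shows "det A \<in> \<int>"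
proof -
  have "A = map_mat of_int (map_mat floor A)"
    using assms by (intro eq_matI) (auto elim!: Ints_cases)
  then have "det A = of_int (det (map_mat floor A))"
    by (metis of_int_hom.hom_det)
  then show ?thesis by simp
qed

text \<open>After pivoting on a corner entry, each of the \<open>k\<close> remaining rows yields a
  factor 2; what is left is a nonzero integer determinant.\<close>

lemma pm1_det_lower_bound:
  assumes A: "A \<in> pm1_mats (Suc k)" and nz: "det A \<noteq> 0"
  shows "2 ^ k \<le> \<bar>det A\<bar>"
proof -
  have car: "A \<in> carrier_mat (Suc k) (Suc k)" using A by (simp add: pm1_mats_def)
  have e: "A $$ (i, j) = 1 \<or> A $$ (i, j) = -1" if "i < Suc k" "j < Suc k" for i j
    using A that by (auto simp: pm1_mats_def)
  \<comment> \<open>The Schur complement of a corner entry has all entries in {0, 2, -2}.\<close>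
  define S where "S = mat k k (\<lambda>(i, j).
    (A $$ (Suc i, Suc j) - A $$ (Suc i, 0) * A $$ (0, Suc j) / A $$ (0, 0)) / 2)"
  have "det A = A $$ (0, 0) * det (mat k k (\<lambda>(i, j).
      A $$ (Suc i, Suc j) - A $$ (Suc i, 0) * A $$ (0, Suc j) / A $$ (0, 0)))"
    by (rule det_schur_complement[OF car]) (use e[of 0 0] in auto)
  also have "mat k k (\<lambda>(i, j).
      A $$ (Suc i, Suc j) - A $$ (Suc i, 0) * A $$ (0, Suc j) / A $$ (0, 0)) = 2 \<cdot>\<^sub>m S"
    by (intro eq_matI) (auto simp: S_def)
  finally have "det A = A $$ (0, 0) * det (2 \<cdot>\<^sub>m S)" .
  then have d: "det A = A $$ (0, 0) * (2 ^ k * det S)" by (simp add: S_def)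
  have "det S \<in> \<int>"
  proof (rule det_integral)
    show "S \<in> carrier_mat k k" by (simp add: S_def)
    fix i j assume "i < k" "j < k"
    then show "S $$ (i, j) \<in> \<int>"
      using e[of 0 0] e[of "Suc i" "Suc j"] e[of "Suc i" 0] e[of 0 "Suc j"]
      by (auto simp: S_def)
  qed
  moreover have "det S \<noteq> 0" using d nz by auto
  ultimately have "1 \<le> \<bar>det S\<bar>" using Ints_nonzero_abs_ge1 by blast
  moreover have "\<bar>det A\<bar> = 2 ^ k * \<bar>det S\<bar>"
    using d e[of 0 0] by (auto simp: abs_mult)
  ultimately show ?thesis by simp
qed

section \<open>Nonsingular submatrices and complementary minors\<close>

text \<open>The top rows are removed one at a time: a nonzero determinant has a nonzero cofactor
  along its first row. The surviving rows are thus always the last \<open>h - e\<close>, and only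
  the columns, listed by \<open>p\<close>, depend on the matrix.\<close>

lemma nonsingular_column_selection:
  fixes A :: "'a :: comm_ring_1 mat"
  assumes A: "A \<in> carrier_mat h h" and nz: "det A \<noteq> 0" and "e \<le> h"
  shows "\<exists>p. inj_on p {..<h - e} \<and> p ` {..<h - e} \<subseteq> {..<h} \<and>
    det (mat (h - e) (h - e) (\<lambda>(i, j). A $$ (e + i, p j))) \<noteq> 0"
  using \<open>e \<le> h\<close>
proof (induction e)
  case 0
  have "mat h h (\<lambda>(i, j). A $$ (i, j)) = A" using A by (intro eq_matI) auto
  then show ?case using nz by (intro exI[of _ id]) auto
next
  case (Suc e)
  define d where "d = h - Suc e"
  have d: "h - e = Suc d" using Suc.prems by (simp add: d_def)
  obtain p where p: "inj_on p {..<Suc d}" "p ` {..<Suc d} \<subseteq> {..<h}"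
    and nzp: "det (mat (Suc d) (Suc d) (\<lambda>(i, j). A $$ (e + i, p j))) \<noteq> 0"
    using Suc by (auto simp: d)
  let ?B = "mat (Suc d) (Suc d) (\<lambda>(i, j). A $$ (e + i, p j))"
  have "det ?B = (\<Sum>j<Suc d. ?B $$ (0, j) * cofactor ?B 0 j)"
    by (rule laplace_expansion_row) auto
  then obtain j where j: "j < Suc d" and "cofactor ?B 0 j \<noteq> 0"
    using nzp by (metis (no_types, lifting) lessThan_iff mult_zero_right sum.neutral)
  then have "det (mat_delete ?B 0 j) \<noteq> 0" by (auto simp: cofactor_def)
  \<comment> \<open>Deleting row 0 moves the row offset from \<open>e\<close> to
    \<open>Suc e\<close>; \<open>insert_index j\<close> lists the columns other than
    \<open>j\<close>.\<close>
  also have "mat_delete ?B 0 j = mat d d (\<lambda>(i, k). A $$ (Suc e + i, p (insert_index j k)))"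
    by (intro eq_matI) (auto simp: mat_delete_def insert_index_def)
  finally have "det (mat d d (\<lambda>(i, k). A $$ (Suc e + i, (p \<circ> insert_index j) k))) \<noteq> 0" by simp
  moreover have ii: "inj_on (insert_index j) {..<d}" "insert_index j ` {..<d} \<subseteq> {..<Suc d}"
    by (auto simp: inj_on_def insert_index_def split: if_splits)
  have "inj_on (p \<circ> insert_index j) {..<d}"
    using ii p(1) by (meson comp_inj_on inj_on_subset)
  moreover have "(p \<circ> insert_index j) ` {..<d} \<subseteq> {..<h}"
    using ii(2) p(2) by (force simp: image_subset_iff)
  ultimately show ?case unfolding d_def by blast
qed

text \<open>Reordering columns by \<open>q\<close> places the selected ones last, which turns a
  selected submatrix of the bottom rows into the lower right block required by
  \<open>complementary_minor\<close>.\<close>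

lemma extend_to_permutation:
  fixes p :: "nat \<Rightarrow> nat"
  assumes p: "inj_on p {..<d}" "p ` {..<d} \<subseteq> {..<n + d}"
  obtains q where "bij_betw q {..<n + d} {..<n + d}" and "\<And>j. j < d \<Longrightarrow> q (n + j) = p j"
proof -
  have "card ({..<n + d} - p ` {..<d}) = n"
    using p by (simp add: card_Diff_subset card_image)
  then obtain g where g: "bij_betw g {..<n} ({..<n + d} - p ` {..<d})"
    by (metis bij_betw_iff_card card_lessThan finite_Diff finite_lessThan)
  define q where "q t = (if t \<in> {..<n} then g t else p (t - n))" for t
  have "bij_betw (\<lambda>t. p (t - n)) {n..<n + d} (p ` {..<d})"
  proof (rule bij_betw_trans[of "\<lambda>t. t - n" _ "{..<d}" p, unfolded comp_def])
    show "bij_betw (\<lambda>t. t - n) {n..<n + d} {..<d}"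
      by (rule bij_betw_byWitness[of _ "\<lambda>t. t + n"]) auto
    show "bij_betw p {..<d} (p ` {..<d})" using p by (simp add: bij_betw_def)
  qed
  then have "bij_betw q ({..<n} \<union> {n..<n + d}) (({..<n + d} - p ` {..<d}) \<union> p ` {..<d})"
    unfolding q_def using g by (intro bij_betw_disjoint_Un) auto
  moreover have "{..<n} \<union> {n..<n + d} = {..<n + d}" by auto
  moreover have "({..<n + d} - p ` {..<d}) \<union> p ` {..<d} = {..<n + d}" using p by auto
  ultimately show ?thesis using that[of q] by (simp add: q_def)
qed

lemma sum_lessThan_add:
  "(\<Sum>j<n + d. f j) = (\<Sum>j<n. f j) + (\<Sum>j<d. f (n + j))" for f :: "nat \<Rightarrow> 'a :: comm_monoid_add"
  by (induction d) (auto simp: add.assoc)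

text \<open>If M M^T = s I for M = [A, B; C, D], then [A, B; C, D] [I, C^T; 0, D^T] = [A, 0; C, s I];
  take determinants.\<close>

lemma complementary_minor:
  fixes H :: "nat \<Rightarrow> nat \<Rightarrow> real"
  assumes orth: "\<And>i k. i < n + d \<Longrightarrow> k < n + d \<Longrightarrow> (\<Sum>j<n + d. H i j * H k j) = (if i = k then s else 0)"
  shows "\<bar>det (mat (n + d) (n + d) (\<lambda>(i, j). H i j))\<bar> * \<bar>det (mat d d (\<lambda>(i, j). H (n + i) (n + j)))\<bar>
    = \<bar>s\<bar> ^ d * \<bar>det (mat n n (\<lambda>(i, j). H i j))\<bar>"
proof -
  define A where "A = mat n n (\<lambda>(i, j). H i j)"
  define B where "B = mat n d (\<lambda>(i, j). H i (n + j))"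
  define C where "C = mat d n (\<lambda>(i, j). H (n + i) j)"
  define D where "D = mat d d (\<lambda>(i, j). H (n + i) (n + j))"
  have car: "A \<in> carrier_mat n n" "B \<in> carrier_mat n d" "C \<in> carrier_mat d n" "D \<in> carrier_mat d d"
    by (auto simp: A_def B_def C_def D_def)
  let ?M = "four_block_mat A B C D"
  let ?Z = "four_block_mat (1\<^sub>m n) (transpose_mat C) (0\<^sub>m d n) (transpose_mat D)"
  have M: "mat (n + d) (n + d) (\<lambda>(i, j). H i j) = ?M"
    by (intro eq_matI) (auto simp: A_def B_def C_def D_def)
  \<comment> \<open>\<open>AB\<close> and \<open>CD\<close> are the blocks in the last
    \<open>d\<close> columns of M M^T = s I.\<close>
  have AB: "A * transpose_mat C + B * transpose_mat D = 0\<^sub>m n d"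
  proof (intro eq_matI)
    fix i k assume "i < dim_row (0\<^sub>m n d :: real mat)" "k < dim_col (0\<^sub>m n d :: real mat)"
    then show "(A * transpose_mat C + B * transpose_mat D) $$ (i, k) = 0\<^sub>m n d $$ (i, k)"
      using orth[of i "n + k"]
      by (simp add: A_def B_def C_def D_def scalar_prod_def atLeast0LessThan sum_lessThan_add)
  qed (use car in auto)
  have CD: "C * transpose_mat C + D * transpose_mat D = s \<cdot>\<^sub>m 1\<^sub>m d"
  proof (intro eq_matI)
    fix i k assume "i < dim_row (s \<cdot>\<^sub>m 1\<^sub>m d)" "k < dim_col (s \<cdot>\<^sub>m 1\<^sub>m d)"
    then show "(C * transpose_mat C + D * transpose_mat D) $$ (i, k) = (s \<cdot>\<^sub>m 1\<^sub>m d) $$ (i, k)"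
      using orth[of "n + i" "n + k"]
      by (simp add: C_def D_def scalar_prod_def atLeast0LessThan sum_lessThan_add)
  qed (use car in auto)
  have "?M * ?Z = four_block_mat (A * 1\<^sub>m n + B * 0\<^sub>m d n) (A * transpose_mat C + B * transpose_mat D)
      (C * 1\<^sub>m n + D * 0\<^sub>m d n) (C * transpose_mat C + D * transpose_mat D)"
    by (rule mult_four_block_mat) (use car in auto)
  also have "\<dots> = four_block_mat A (0\<^sub>m n d) C (s \<cdot>\<^sub>m 1\<^sub>m d)"
    using car by (simp add: AB CD)
  finally have "det (?M * ?Z) = det (four_block_mat A (0\<^sub>m n d) C (s \<cdot>\<^sub>m 1\<^sub>m d))" by simp
  also have "\<dots> = det A * det (s \<cdot>\<^sub>m 1\<^sub>m d)"
    by (rule det_four_block_mat_upper_right_zero) (use car in auto)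
  also have "\<dots> = s ^ d * det A" by simp
  also have "det (?M * ?Z) = det ?M * det ?Z"
    by (rule det_mult[of _ "n + d"]) (use car in auto)
  also have "det ?Z = det (1\<^sub>m n :: real mat) * det (transpose_mat D)"
    by (rule det_four_block_mat_lower_left_zero) (use car in auto)
  also have "\<dots> = det D" using car by (simp add: det_transpose)
  finally have "\<bar>det ?M * det D\<bar> = \<bar>s ^ d * det A\<bar>" by simp
  then show ?thesis by (simp add: M abs_mult power_abs A_def D_def)
qed

section \<open>Bounds on the maximal determinant\<close>

lemma det_le_maxdet: "M \<in> pm1_mats n \<Longrightarrow> det M \<le> maxdet n"
  unfolding maxdet_def using finite_pm1_mats by (intro Max_ge) auto

lemma maxdet_attained: obtains M where "M \<in> pm1_mats n" "det M = maxdet n"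
proof -
  have "maxdet n \<in> det ` pm1_mats n"
    unfolding maxdet_def using finite_pm1_mats pm1_mats_nonempty by (intro Max_in) auto
  then show ?thesis using that by auto
qed

text \<open>Negating a row stays within the sign matrices and flips the sign of the
  determinant.\<close>

lemma abs_det_le_maxdet:
  assumes M: "M \<in> pm1_mats n" and n: "n > 0"
  shows "\<bar>det M\<bar> \<le> maxdet n"
proof -
  have "multrow 0 (-1) M \<in> pm1_mats n"
  proof -
    have car: "M \<in> carrier_mat n n" using M by (simp add: pm1_mats_def)
    have "multrow 0 (-1) M $$ (i, j) \<in> {1, -1}" if "i < n" "j < n" for i j
    proof -
      have "M $$ (i, j) = 1 \<or> M $$ (i, j) = -1" using M that by (auto simp: pm1_mats_def)
      then show ?thesis using car that by auto
    qed
    then show ?thesis using car by (simp add: pm1_mats_def)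
  qed
  then have "det (multrow 0 (-1) M) \<le> maxdet n" by (rule det_le_maxdet)
  moreover have "det (multrow 0 (-1) M) = - det M"
    using M n by (subst det_multrow) (auto simp: pm1_mats_def)
  ultimately show ?thesis using det_le_maxdet[OF M] by linarith
qed

lemma maxdet_Suc:
  assumes n: "n > 0"
  shows "2 * maxdet n \<le> maxdet (Suc n)"
proof -
  obtain M where M: "M \<in> pm1_mats n" and dM: "det M = maxdet n" by (rule maxdet_attained)
  have car: "M \<in> carrier_mat n n" using M by (simp add: pm1_mats_def)
  \<comment> \<open>\<open>W\<close> = [2, 0; -1, M] has determinant 2 det M. Adding its row 1 to
    its row 0 turns (2, 0) into (1, first row of \<open>M\<close>), so that all entries become signs
    while the determinant is kept.\<close>
  define W where "W = four_block_mat (mat 1 1 (\<lambda>_. 2)) (0\<^sub>m 1 n) (mat n 1 (\<lambda>_. -1)) M"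
  have W: "W \<in> carrier_mat (Suc n) (Suc n)" 
    using four_block_carrier_mat[of "mat 1 1 (\<lambda>_. 2)" 1 1 M n n] car by (simp add: W_def)
  have "det W = det (mat 1 1 (\<lambda>_. 2 :: real)) * det M"
    unfolding W_def by (rule det_four_block_mat_upper_right_zero) (use car in auto)
  then have "det W = 2 * maxdet n" by (simp add: dM det_single)
  moreover have "det (addrow 1 0 1 W) = det W"
    by (rule det_addrow[OF _ _ W]) (use n in auto)
  moreover have "addrow 1 0 1 W \<in> pm1_mats (Suc n)"
  proof -
    have e: "M $$ (i, j) = 1 \<or> M $$ (i, j) = -1" if "i < n" "j < n" for i j
      using M that by (auto simp: pm1_mats_def)
    have W_entries: "W $$ (0, 0) = 2" "W $$ (Suc i, 0) = -1" "W $$ (0, Suc j) = 0"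
      "W $$ (Suc i, Suc j) = M $$ (i, j)" if "i < n" "j < n" for i j
      using that car by (simp_all add: W_def)
    have dim: "dim_row W = Suc n" "dim_col W = Suc n" using W by auto
    have "addrow 1 0 1 W $$ (i, j) \<in> {1, -1}" if ij: "i < Suc n" "j < Suc n" for i j
    proof -
      have "addrow 1 0 1 W $$ (i, j) = (if i = 0 then W $$ (Suc 0, j) + W $$ (0, j) else W $$ (i, j))"
        using ij by (simp add: dim)
      then show ?thesis
        using ij n e[of 0 "j - 1"] e[of "i - 1" "j - 1"] W_entries[of 0 "j - 1"] W_entries[of "i - 1" "j - 1"]
          W_entries[of 0 0] W_entries[of "i - 1" 0]
        by (cases i; cases j) auto
    qed
    then show ?thesis using W by (simp add: pm1_mats_def)
  qed
  ultimately show ?thesis using det_le_maxdet[of "addrow 1 0 1 W" "Suc n"] by simp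
qed

lemma maxdet_add:
  assumes n: "n > 0"
  shows "2 ^ d * maxdet n \<le> maxdet (n + d)"
proof (induction d)
  case (Suc d)
  then show ?case using maxdet_Suc[of "n + d"] n by simp
qed simp

text \<open>The columns of a nonsingular submatrix in the last \<open>Suc k\<close> rows are moved
  to the right. The complementary upper left block \<open>A\<close> is a sign matrix of order
  \<open>n\<close>, and \<open>complementary_minor\<close> carries the lower bound for
  \<open>det D\<close> over to it.\<close>

lemma maxdet_below_hadamard_order:
  assumes h: "Suc k + n \<in> hadamard_orders" and n: "n > 0"
  shows "2 ^ k * real (Suc k + n) powr (real (Suc k + n) / 2 - real (Suc k)) \<le> maxdet n"
proof -
  define d where "d = Suc k"
  define h where "h = n + d"
  obtain M where H: "hadamard_matrix h M"
    using h by (auto simp: hadamard_orders_def h_def d_def add.commute)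
  then have pm: "M \<in> pm1_mats h" and dM: "\<bar>det M\<bar> = real h powr (real h / 2)"
    by (auto simp: hadamard_matrix_def)
  have h0: "h > 0" using n by (simp add: h_def)
  have car: "M \<in> carrier_mat h h" using pm by (simp add: pm1_mats_def)
  have "det M \<noteq> 0" using dM h0 by auto
  \<comment> \<open>Dropping the first \<open>n\<close> rows leaves exactly the last
    \<open>d\<close>.\<close>
  then obtain p where p: "inj_on p {..<d}" "p ` {..<d} \<subseteq> {..<n + d}"
    and nz: "det (mat d d (\<lambda>(i, j). M $$ (n + i, p j))) \<noteq> 0"
    using nonsingular_column_selection[OF car, of n] by (auto simp: h_def)
  obtain q where q: "bij_betw q {..<h} {..<h}" and qp: "\<And>j. j < d \<Longrightarrow> q (n + j) = p j"
    using extend_to_permutation[OF p] unfolding h_def by metis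
  define H where "H i j = M $$ (i, q j)" for i j
  have qh: "q j < h" if "j < h" for j using q that by (auto simp: bij_betw_def)
  have entry: "H i j \<in> {1, -1}" if "i < h" "j < h" for i j
    using pm qh that unfolding H_def pm1_mats_def by blast
  have orth: "(\<Sum>j<h. H i j * H k j) = (if i = k then real h else 0)" if "i < h" "k < h" for i k
  proof -
    have "(\<Sum>j<h. H i j * H k j) = (\<Sum>j<h. M $$ (i, j) * M $$ (k, j))"
      unfolding H_def by (rule sum.reindex_bij_betw[OF q])
    also have "\<dots> = (if i = k then real h else 0)"
      using hadamard_matrix_orthogonal[OF \<open>hadamard_matrix h M\<close> that] pm1_mats_square[OF pm that(1)]
      by (auto simp flip: power2_eq_square)
    finally show ?thesis .
  qed
  define A where "A = mat n n (\<lambda>(i, j). H i j)"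
  define D where "D = mat d d (\<lambda>(i, j). H (n + i) (n + j))"
  have "\<bar>det (mat h h (\<lambda>(i, j). H i j))\<bar> * \<bar>det D\<bar> = real h ^ d * \<bar>det A\<bar>"
    using complementary_minor[of n d H "real h"] orth by (simp add: h_def A_def D_def)
  \<comment> \<open>Instead of tracking the sign of \<open>q\<close>, take the complementary minor
    identity with an empty upper left block: both factors on the left become the full determinant,
    and the empty minor is 1.\<close>
  moreover have "\<bar>det (mat h h (\<lambda>(i, j). H i j))\<bar> = real h powr (real h / 2)"
  proof -
    let ?X = "mat h h (\<lambda>(i, j). H i j)"
    have "\<bar>det ?X\<bar> * \<bar>det ?X\<bar> = real h ^ h"
      using complementary_minor[of 0 h H "real h"] orth by simp
    also have "\<dots> = real h powr (real h / 2) * real h powr (real h / 2)"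
      using h0 by (simp add: powr_realpow flip: powr_add)
    finally show ?thesis
      using power2_eq_imp_eq[OF _ abs_ge_zero powr_ge_zero] by (simp add: power2_eq_square)
  qed
  moreover have "2 ^ k \<le> \<bar>det D\<bar>"
  proof (rule pm1_det_lower_bound)
    show "D \<in> pm1_mats (Suc k)"
      using entry by (auto simp: pm1_mats_def D_def h_def d_def)
    have "D = mat d d (\<lambda>(i, j). M $$ (n + i, p j))"
      by (intro eq_matI) (auto simp: D_def H_def qp)
    then show "det D \<noteq> 0" using nz by simp
  qed
  ultimately have "real h powr (real h / 2) * 2 ^ k \<le> real h ^ d * \<bar>det A\<bar>"
    by (metis mult_left_mono powr_ge_zero)
  moreover have "A \<in> pm1_mats n"
    using entry by (auto simp: pm1_mats_def A_def h_def)
  then have "\<bar>det A\<bar> \<le> maxdet n" using n by (rule abs_det_le_maxdet)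
  ultimately have "real h powr (real h / 2) * 2 ^ k \<le> real h ^ d * maxdet n"
    by (meson mult_left_mono of_nat_0_le_iff order_trans zero_le_power)
  then have "2 ^ k * (real h powr (real h / 2) / real h ^ d) \<le> maxdet n"
    using h0 by (simp add: field_simps)
  also have "real h powr (real h / 2) / real h ^ d = real h powr (real h / 2 - real d)"
    using h0 by (simp add: powr_diff powr_realpow)
  finally show ?thesis by (simp add: h_def d_def add.commute)
qed

section \<open>Numerical estimates and the final comparison\<close>

text \<open>The first four terms of the series are 1 + 1 + 1/2 + 1/6 = 8/3.\<close>

lemma exp_one_ge: "8 / 3 \<le> exp (1 :: real)"
proof -
  have "(\<Sum>k<4. 1 ^ k /\<^sub>R fact k) \<le> (\<Sum>k. (1 :: real) ^ k /\<^sub>R fact k)"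
    by (rule sum_le_suminf[OF summable_exp_generic]) auto
  then show ?thesis by (simp add: exp_def eval_nat_numeral lessThan_Suc)
qed

text \<open>This is the comparison of exponents for the Hadamard order n + 1, where the margin is
  small. Split 4 = (3/2)(8/3): Bernoulli gives (1 + 1/n)^(n - 1) \<ge> 1 + (n - 1)/n \<ge> 3/2, and
  8/3 is at most e.\<close>

lemma two_ln_two_le:
  assumes n: "n \<ge> 2"
  shows "2 * ln 2 \<le> 1 + (real n - 1) * (ln (real n + 1) - ln (real n))"
proof -
  have "3 / 2 \<le> 1 + real (n - 1) * (1 / real n)"
    using n by (simp add: field_simps of_nat_diff)
  also have "\<dots> \<le> (1 + 1 / real n) ^ (n - 1)"
    by (rule Bernoulli_inequality) (use n in \<open>auto intro: order_trans[of _ 0]\<close>)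
  finally have "ln (3 / 2) \<le> ln ((1 + 1 / real n) ^ (n - 1))" by (subst ln_le_cancel_iff) (auto simp: add_pos_nonneg)
  also have "\<dots> = (real n - 1) * ln (1 + 1 / real n)"
    using n by (subst ln_realpow) (auto simp: add_pos_nonneg of_nat_diff)
  also have "1 + 1 / real n = (real n + 1) / real n" using n by (simp add: field_simps)
  also have "ln \<dots> = ln (real n + 1) - ln (real n)" using n by (subst ln_div) auto
  finally have "ln (3 / 2) \<le> (real n - 1) * (ln (real n + 1) - ln (real n))" .
  moreover have "ln (8 / 3 :: real) \<le> 1"
    using exp_one_ge ln_le_cancel_iff[of "8 / 3" "exp (1 :: real)"] by simp
  moreover have "2 * ln 2 = ln (3 / 2) + ln (8 / 3 :: real)"
  proof -
    have "2 * ln 2 = ln ((2 :: real) ^ 2)" by (subst ln_realpow) auto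
    also have "(2 :: real) ^ 2 = 3 / 2 * (8 / 3)" by simp
    finally show ?thesis by (subst (asm) ln_mult) auto
  qed
  ultimately show ?thesis by linarith
qed

text \<open>In this form the theorem becomes a comparison of exponents that is linear in the
  logarithms.\<close>

lemma bound_as_exp:
  assumes "n > 0"
  shows "(4 / (real n * exp 1)) powr (real d / 2) * real n powr (real n / 2)
    = exp (real d / 2 * (2 * ln 2 - ln (real n) - 1) + real n / 2 * ln (real n))"
proof -
  have "ln (4 :: real) = ln (2 ^ 2)" by simp
  also have "\<dots> = 2 * ln 2" by (subst ln_realpow) auto
  finally have "ln (4 / (real n * exp 1)) = 2 * ln 2 - ln (real n) - 1"
    using assms by (simp add: ln_div ln_mult)
  then show ?thesis using assms by (simp add: powr_def exp_add)
qed

theorem theorem1: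
  fixes n :: nat
  assumes "n > 0"
  defines "\<delta> \<equiv> hadamard_gap n"
  shows "maxdet_ratio n \<ge> (4 / (real n * exp 1)) powr (real \<delta> / 2)"
proof -
  have gap: "\<delta> < n"
    using hadamard_gap_le[OF one_in_hadamard_orders, of n] assms by simp
  obtain h where h: "h \<in> hadamard_orders" and dh: "\<delta> = nat \<bar>int n - int h\<bar>"
    using hadamard_gap_attained[of n] by (auto simp: \<delta>_def)
  have h0: "h > 0" using h by (simp add: hadamard_orders_def)
  have "exp (real \<delta> / 2 * (2 * ln 2 - ln (real n) - 1) + real n / 2 * ln (real n)) \<le> maxdet n"
  proof (cases "h \<le> n")
    case True
    then have n: "n = h + \<delta>" using dh by simp
    \<comment> \<open>The exponent of the lower bound exceeds the required one by half of \<delta> -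
      h ln (n/h), so h ln (n/h) \<le> n - h = \<delta> suffices.\<close>
    have "ln (real n / real h) \<le> real n / real h - 1"
      using h0 assms by (intro ln_le_minus_one) auto
    then have "real h * (ln (real n) - ln (real h)) \<le> real h * (real n / real h - 1)"
      using h0 assms by (intro mult_left_mono) (auto simp: ln_div)
    also have "\<dots> = real \<delta>" using h0 n by (simp add: right_diff_distrib)
    finally have "real \<delta> / 2 * (2 * ln 2 - ln (real n) - 1) + real n / 2 * ln (real n)
      \<le> real \<delta> * ln 2 + real h / 2 * ln (real h)"
      by (simp add: n field_simps)
    then have "exp (real \<delta> / 2 * (2 * ln 2 - ln (real n) - 1) + real n / 2 * ln (real n))
      \<le> exp (real \<delta> * ln 2 + real h / 2 * ln (real h))" by simp
    also have "\<dots> = 2 ^ \<delta> * real h powr (real h / 2)"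
      using h0 by (simp add: exp_add powr_def exp_of_nat_mult)
    also have "\<dots> \<le> 2 ^ \<delta> * maxdet h"
      using h h0 abs_det_le_maxdet[of _ h]
      by (fastforce simp: hadamard_orders_def hadamard_matrix_def)
    also have "\<dots> \<le> maxdet n" using maxdet_add[OF h0] n by simp
    finally show ?thesis .
  next
    case False
    define k where "k = \<delta> - 1"
    have d: "\<delta> = Suc k" and hn: "h = Suc k + n" using False dh by (auto simp: k_def)
    have pos: "0 \<le> ln (real h) - ln (real n)" using assms False by simp
    \<comment> \<open>Twice the difference of the two exponents is the right side minus the left
      side. The term 2 ln 2 is the cost of having only \<open>2 ^ k\<close> with \<open>k\<close> =
      \<delta> - 1 as the bound for the small minor.\<close>
    have "2 * ln 2 \<le> real \<delta> + (real n - real \<delta>) * (ln (real h) - ln (real n))"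
    proof (cases "k = 0")
      case True
      \<comment> \<open>Here \<delta> = 1, and \<delta> < n supplies n \<ge> 2.\<close>
      then show ?thesis using two_ln_two_le[of n] gap by (simp add: d hn add.commute)
    next
      case False
      \<comment> \<open>For \<delta> \<ge> 2 the first summand alone suffices, because ln 2 \<le>
        1.\<close>
      then have "2 \<le> real \<delta>" by (simp add: d)
      moreover have "ln 2 \<le> (1 :: real)" using ln_le_minus_one[of "2 :: real"] by simp
      moreover have "0 \<le> (real n - real \<delta>) * (ln (real h) - ln (real n))"
        using gap pos by simp
      ultimately show ?thesis by linarith
    qed
    then have "real \<delta> / 2 * (2 * ln 2 - ln (real n) - 1) + real n / 2 * ln (real n)
      \<le> real k * ln 2 + (real h / 2 - real \<delta>) * ln (real h)"
      unfolding d hn by (simp add: field_simps)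
    then have "exp (real \<delta> / 2 * (2 * ln 2 - ln (real n) - 1) + real n / 2 * ln (real n))
      \<le> exp (real k * ln 2 + (real h / 2 - real \<delta>) * ln (real h))" by simp
    also have "\<dots> = 2 ^ k * real h powr (real h / 2 - real \<delta>)"
      using h0 by (simp add: exp_add powr_def exp_of_nat_mult)
    also have "\<dots> \<le> maxdet n"
      using maxdet_below_hadamard_order[of k n] h assms unfolding d hn by blast
    finally show ?thesis .
  qed
  then have "(4 / (real n * exp 1)) powr (real \<delta> / 2) * real n powr (real n / 2) \<le> maxdet n"
    by (simp only: bound_as_exp[OF \<open>n > 0\<close>])
  then show ?thesis
    using \<open>n > 0\<close> by (simp add: maxdet_ratio_def pos_le_divide_eq)
qed

end
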